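(* Let $k\ge1$ and let $y=(y_w)_{\deg w\le 2k}$ be a truncated tracial sequence of order $2k$. If $\operatorname{rank}M_k(y)=\operatorname{rank}M_{k-1}(y)$, then there exists a unique truncated tracial sequence $\tilde y=(\tilde y_w)_{\deg w\le 2k+2}$ extending $y$ (i.e. $\tilde y_w=y_w$ whenever $\deg w\le 2k$) such that $M_{k+1}(\tilde y)$ is a flat extension of $M_k(y)$.
   Context: Let $\langle\underline X\rangle$ be the free monoid of words in the non-commuting letters $\underline X=(X_1,\dots,X_n)$, with empty word $\emptyset=1$. For a word $w$, $w^*$ is the reversed word and $\deg w$ its length. Two words are cyclically equivalent, $w\overset{\mathrm{cyc}}{\sim}u$, if $u$ is a cyclic permutation of $w$. A truncated tracial sequence of order $m$ is a family of real numbers $(y_w)$ indexed by the words $w$ with $\deg w\le m$ such that $y_w=y_u$ whenever $w\overset{\mathrm{cyc}}{\sim}u$, $y_w=y_{w^*}$ for all such $w$, and $y_\emptyset=1$. For $2k\le m$, its tracial moment matrix of order $k$ is $M_k(y)=(y_{u^*v})_{u,v}$, indexed by words $u,v$ with $\deg u,\deg v\le k$. A symmetric matrix $\tilde A=\begin{pmatrix} A & B \\ {B}^* & C \end{pmatrix}$ is a flat extension of the symmetric matrix $A$ if $\operatorname{rank}A=\operatorname{rank}\tilde A$. *)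

theory Defs
  imports "Jordan_Normal_Form.DL_Rank" "HOL-Library.FuncSet"
begin

text \<open>
  The letters \<open>X\<^sub>1, \<dots>, X\<^sub>n\<close> are represented by the numbers \<open>0, \<dots>, n - 1\<close> and words by lists
  of letters, so that the involution of words is \<^const>\<open>rev\<close> and the degree is \<^const>\<open>length\<close>.
\<close>

definition words :: "nat \<Rightarrow> nat \<Rightarrow> nat list set" where
  "words n d = {w. set w \<subseteq> {..<n} \<and> length w \<le> d}"

definition cyc_equiv :: "nat list \<Rightarrow> nat list \<Rightarrow> bool" where
  "cyc_equiv w u \<longleftrightarrow> (\<exists>i. u = rotate i w)"

text \<open>
  A family indexed by the words of degree at most \<open>m\<close> is a function that is \<^const>\<open>undefined\<close>
  outside \<^term>\<open>words n m\<close>; thus equality of families is equality of functions.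
\<close>

definition truncated_tracial_seq :: "nat \<Rightarrow> nat \<Rightarrow> (nat list \<Rightarrow> real) \<Rightarrow> bool" where
  "truncated_tracial_seq n m y \<longleftrightarrow>
     y \<in> extensional (words n m) \<and>
     (\<forall>w \<in> words n m. \<forall>u \<in> words n m. cyc_equiv w u \<longrightarrow> y w = y u) \<and>
     (\<forall>w \<in> words n m. y w = y (rev w)) \<and>
     y [] = 1"

text \<open>
  Matrices in the library are indexed by natural numbers, so the words of degree at most \<open>d\<close> are
  enumerated by increasing degree. The enumeration for degree \<open>d\<close> is therefore an initial
  segment of the one for degree \<open>d + 1\<close>, and the moment matrix of order \<open>d\<close> is the upper left block
  of the one of order \<open>d + 1\<close>.
\<close>

definition word_list :: "nat \<Rightarrow> nat \<Rightarrow> nat list list" where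
  "word_list n d = concat (map (\<lambda>j. List.n_lists j [0..<n]) [0..<Suc d])"

lemma set_word_list: "set (word_list n d) = words n d"
  by (fastforce simp: word_list_def words_def set_n_lists less_Suc_eq_le)

lemma distinct_word_list: "distinct (word_list n d)"
proof (induction d)
  case 0
  then show ?case by (simp add: word_list_def)
next
  case (Suc d)
  have "word_list n (Suc d) = word_list n d @ List.n_lists (Suc d) [0..<n]"
    by (simp add: word_list_def del: n_lists.simps)
  moreover have "set (word_list n d) \<inter> set (List.n_lists (Suc d) [0..<n]) = {}"
    unfolding set_word_list by (auto simp: words_def set_n_lists simp del: n_lists.simps)
  ultimately show ?case
    using Suc by (simp add: distinct_n_lists del: n_lists.simps)
qed

definition moment_matrix :: "nat \<Rightarrow> nat \<Rightarrow> (nat list \<Rightarrow> real) \<Rightarrow> real mat" where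
  "moment_matrix n k y =
     mat (length (word_list n k)) (length (word_list n k))
       (\<lambda>(i, j). y (rev (word_list n k ! i) @ word_list n k ! j))"

abbreviation mat_rank :: "real mat \<Rightarrow> nat" where
  "mat_rank A \<equiv> vec_space.rank (dim_row A) A"

definition flat_extension :: "real mat \<Rightarrow> real mat \<Rightarrow> bool" where
  "flat_extension A A' \<longleftrightarrow>
     A\<^sup>T = A \<and> A'\<^sup>T = A' \<and>
     (\<exists>r s B C. A \<in> carrier_mat r r \<and> B \<in> carrier_mat r s \<and> C \<in> carrier_mat s s \<and>
        A' = four_block_mat A B B\<^sup>T C) \<and>
     mat_rank A = mat_rank A'"

end

theory Submission
  imports Defs
begin

text \<open>
  The rank condition says that every word \<open>v\<close> of degree at most \<open>k\<close> agrees, modulo the kernel of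
  \<open>M\<^sub>k(y)\<close>, with a polynomial \<open>p\<^sub>v\<close> of degree at most \<open>k - 1\<close>. Positivity is not available,
  but the symmetric bilinear form of \<open>M\<^sub>k(y)\<close> is nondegenerate on the quotient \<open>H\<close> by the kernel,
  and left and right multiplication by a letter define self-adjoint operators on \<open>H\<close>. Each left
  multiplication commutes with each right multiplication. Applying the left multiplications to the
  class of the empty word gives \<open>y'(w) = \<langle>1, w 1\<rangle>\<close>; self-adjointness yields invariance under
  reversal, and replacing a left by a right multiplication on \<open>1\<close> yields cyclic invariance. All
  moment matrices of \<open>y'\<close> are Gram matrices of vectors in \<open>H\<close>, hence flat.

  Conversely, the kernel of a flat extension is closed under left multiplication by letters, and
  the relations \<open>X v \<equiv> X p\<^sub>v\<close> determine the values of degree \<open>2k + 1\<close>, and then those of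
  degree \<open>2k + 2\<close>.
\<close>

subsection \<open>Ranks of matrices given by kernel functions\<close>

definition kernel_mat :: "('a \<Rightarrow> 'b \<Rightarrow> 'c) \<Rightarrow> 'a list \<Rightarrow> 'b list \<Rightarrow> 'c mat" where
  "kernel_mat f xs ys = mat (length xs) (length ys) (\<lambda>(i, j). f (xs ! i) (ys ! j))"

definition kernel_rank :: "('a \<Rightarrow> 'b \<Rightarrow> 'c :: field) \<Rightarrow> 'a list \<Rightarrow> 'b list \<Rightarrow> nat" where
  "kernel_rank f xs ys = vec_space.rank (length xs) (kernel_mat f xs ys)"

definition kernel_col :: "('a \<Rightarrow> 'b \<Rightarrow> 'c) \<Rightarrow> 'a list \<Rightarrow> 'b \<Rightarrow> 'c vec" where
  "kernel_col f xs y = vec (length xs) (\<lambda>i. f (xs ! i) y)"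

lemma kernel_mat_carrier [simp]: "kernel_mat f xs ys \<in> carrier_mat (length xs) (length ys)"
  by (simp add: kernel_mat_def)

lemma kernel_col_carrier [simp]: "kernel_col f xs y \<in> carrier_vec (length xs)"
  by (simp add: kernel_col_def)

lemma cols_kernel_mat: "cols (kernel_mat f xs ys) = map (kernel_col f xs) ys"
  by (rule nth_equalityI) (auto simp: kernel_mat_def kernel_col_def)

text \<open>Column-space membership in terms of index sets, on the rows \<open>X\<close> only. The
  coefficients may depend on \<open>z\<close> but not on the row.\<close>

definition col_comb :: "('a \<Rightarrow> 'b \<Rightarrow> 'c :: comm_semiring_0) \<Rightarrow> 'a set \<Rightarrow> 'b set \<Rightarrow> 'b \<Rightarrow> bool" where
  "col_comb f X Y z \<longleftrightarrow> (\<exists>c. \<forall>x\<in>X. f x z = (\<Sum>y\<in>Y. c y * f x y))"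

lemma col_comb_member:
  fixes f :: "'a \<Rightarrow> 'b \<Rightarrow> 'c :: comm_semiring_1"
  assumes "finite Y" "z \<in> Y"
  shows "col_comb f X Y z"
  unfolding col_comb_def
  by (rule exI[of _ "\<lambda>y. if y = z then 1 else 0"]) (simp add: assms if_distrib[of "\<lambda>t. t * _"] cong: if_cong)

text \<open>\<open>col_space_eq\<close> identifies the span of the columns with the image of the
  matrix. Distinctness of \<open>ys\<close> turns sums over positions into sums over the set of
  indices.\<close>

lemma kernel_col_in_span_iff:
  fixes f :: "'a \<Rightarrow> 'b \<Rightarrow> 'c :: field"
  assumes "distinct ys"
  shows "kernel_col f xs z \<in> LinearCombinations.module.span class_ring (module_vec TYPE('c) (length xs)) (kernel_col f xs ` set ys)
    \<longleftrightarrow> col_comb f (set xs) (set ys) z"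
proof -
  interpret vec_space "TYPE('c)" "length xs" .
  have sum: "(\<Sum>j<length ys. g (ys ! j)) = sum g (set ys)" for g :: "'b \<Rightarrow> 'c"
    using assms sum.reindex_bij_betw[OF bij_betw_nth[OF assms refl refl], of g] by simp
  have mv: "kernel_mat f xs ys *\<^sub>v v = vec (length xs) (\<lambda>i. \<Sum>j<length ys. v $ j * f (xs ! i) (ys ! j))"
    if "v \<in> carrier_vec (length ys)" for v
    using that by (intro eq_vecI)
      (auto simp: kernel_mat_def scalar_prod_def mult.commute atLeast0LessThan intro!: sum.cong)
  have "kernel_col f xs z \<in> span (kernel_col f xs ` set ys) \<longleftrightarrow>
      (\<exists>v\<in>carrier_vec (length ys). kernel_mat f xs ys *\<^sub>v v = kernel_col f xs z)"
    using col_space_eq[OF kernel_mat_carrier, of f ys] unfolding col_space_def cols_kernel_mat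
    by (auto simp: kernel_mat_def)
  also have "\<dots> \<longleftrightarrow> (\<exists>v\<in>carrier_vec (length ys). \<forall>x\<in>set xs. f x z = (\<Sum>j<length ys. v $ j * f x (ys ! j)))"
    by (intro bex_cong refl, simp add: mv, auto simp: kernel_col_def vec_eq_iff set_conv_nth)
  also have "\<dots> \<longleftrightarrow> col_comb f (set xs) (set ys) z" (is "?L = ?R")
  proof
    assume ?L
    then obtain v where v: "\<forall>x\<in>set xs. f x z = (\<Sum>j<length ys. v $ j * f x (ys ! j))" by blast
    define c where "c y = v $ (THE j. j < length ys \<and> ys ! j = y)" for y
    have "c (ys ! j) = v $ j" if "j < length ys" for j
      unfolding c_def using that assms by (intro arg_cong[of _ _ "($) v"] the_equality) (auto simp: nth_eq_iff_index_eq)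
    then have "(\<Sum>j<length ys. v $ j * f x (ys ! j)) = (\<Sum>y\<in>set ys. c y * f x y)" for x
      unfolding sum[symmetric] by (intro sum.cong) auto
    with v show ?R unfolding col_comb_def by auto
  next
    assume ?R
    then obtain c where c: "\<forall>x\<in>set xs. f x z = (\<Sum>y\<in>set ys. c y * f x y)" unfolding col_comb_def by blast
    show ?L
      by (rule bexI[of _ "vec (length ys) (\<lambda>j. c (ys ! j))"]) (auto simp: c sum[symmetric] intro!: sum.cong)
  qed
  finally show ?thesis .
qed

section \<open>Comparison of ranks through relations between columns\<close>

text \<open>A maximal independent \<open>U\<close> inside \<open>T\<close> has as many elements as
  the dimension of \<open>span T\<close>, and it stays independent in \<open>span S\<close>. If the
  dimensions agree, \<open>U\<close> is a basis of \<open>span S\<close> as well.\<close>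

lemma (in vec_space) dim_span_mono:
  assumes "finite S" "S \<subseteq> carrier_vec n" "finite T" "T \<subseteq> span S"
  shows "vectorspace.dim class_ring (span_vs T) \<le> vectorspace.dim class_ring (span_vs S)"
    and "vectorspace.dim class_ring (span_vs T) = vectorspace.dim class_ring (span_vs S) \<Longrightarrow> S \<subseteq> span T"
proof -
  have Tc: "T \<subseteq> carrier_vec n"
    using assms(2,4) span_is_subset2[of S] by auto
  obtain U where U: "maximal U (\<lambda>U. U \<subseteq> T \<and> lin_indpt U)"
    using maximal_exists_superset[of T "\<lambda>U. U \<subseteq> T \<and> lin_indpt U" "{}"] assms(3)
    by (auto simp: lin_dep_def)
  then have UT: "U \<subseteq> T" and li: "lin_indpt U" by (auto simp: maximal_def)
  have fU: "finite U" using UT assms(3) finite_subset by blast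
  have dT: "vectorspace.dim class_ring (span_vs T) = card U"
    using dim_span[OF _ assms(3) U] Tc by simp
  interpret S: vectorspace class_ring "span_vs S"
    using span_is_subspace[of S] assms(2) subspace_is_vs by simp
  have sub: "submodule class_ring (span S) V" using span_is_submodule assms(2) by simp
  have US: "U \<subseteq> span S" using UT assms(4) by auto
  have li': "S.lin_indpt U"
    using span_li_not_depend(2)[OF US sub] li by simp
  have fd: "S.fin_dim" using fin_dim_span[of S] assms(1,2) by simp
  show "vectorspace.dim class_ring (span_vs T) \<le> vectorspace.dim class_ring (span_vs S)"
    using S.li_le_dim(2)[OF fd _ li'] US by (simp add: dT)
  assume "vectorspace.dim class_ring (span_vs T) = vectorspace.dim class_ring (span_vs S)"
  then have "S.basis U"
    using S.dim_li_is_basis[OF fd fU _ li'] US by (simp add: dT)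
  then have "span U = span S"
    using span_li_not_depend(1)[OF US sub] by (simp add: S.basis_def)
  then show "S \<subseteq> span T"
    using span_is_monotone[OF UT] in_own_span[of S] assms(2) by auto
qed

lemma
  fixes f :: "'a \<Rightarrow> 'b \<Rightarrow> 'c :: field"
  assumes "distinct ys" "\<And>z. z \<in> set zs \<Longrightarrow> col_comb f (set xs) (set ys) z"
  shows kernel_rank_mono_cols: "kernel_rank f xs zs \<le> kernel_rank f xs ys"
    and col_comb_if_kernel_rank_eq: "distinct zs \<Longrightarrow> kernel_rank f xs zs = kernel_rank f xs ys
      \<Longrightarrow> y \<in> set ys \<Longrightarrow> col_comb f (set xs) (set zs) y"
proof -
  interpret vec_space "TYPE('c)" "length xs" .
  let ?C = "kernel_col f xs"
  have sub: "?C ` set zs \<subseteq> span (?C ` set ys)"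
    using kernel_col_in_span_iff[OF assms(1), of f xs] assms(2) by auto
  have S: "finite (?C ` set ys)" "?C ` set ys \<subseteq> carrier_vec (length xs)" "finite (?C ` set zs)" by auto
  show "kernel_rank f xs zs \<le> kernel_rank f xs ys"
    unfolding kernel_rank_def rank_def cols_kernel_mat using dim_span_mono(1)[OF S sub] by simp
  assume "distinct zs" "kernel_rank f xs zs = kernel_rank f xs ys" "y \<in> set ys"
  then show "col_comb f (set xs) (set zs) y"
    using dim_span_mono(2)[OF S sub] kernel_col_in_span_iff[of zs f xs y]
    unfolding kernel_rank_def rank_def cols_kernel_mat by auto
qed

lemma kernel_rank_basis:
  fixes f :: "'a \<Rightarrow> 'b \<Rightarrow> 'c :: field"
  assumes "distinct ys"
  obtains zs where "distinct zs" "set zs \<subseteq> set ys" "length zs = kernel_rank f xs ys"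
    "\<And>y. y \<in> set ys \<Longrightarrow> col_comb f (set xs) (set zs) y"
proof -
  interpret vec_space "TYPE('c)" "length xs" .
  let ?C = "kernel_col f xs"
  let ?P = "\<lambda>U. U \<subseteq> ?C ` set ys \<and> lin_indpt U"
  obtain U where U: "maximal U ?P"
    using maximal_exists_superset[of "?C ` set ys" ?P "{}"] by (auto simp: lin_dep_def)
  have card: "kernel_rank f xs ys = card U"
    unfolding kernel_rank_def using rank_card_indpt[OF kernel_mat_carrier, of U f ys] U
    by (simp add: cols_kernel_mat)
  from U have UT: "U \<subseteq> ?C ` set ys" and li: "lin_indpt U" by (auto simp: maximal_def)
  \<comment> \<open>Different indices may give the same column, so one index is chosen for each
    vector of \<open>U\<close>.\<close>
  obtain Z where Z: "Z \<subseteq> set ys" "inj_on ?C Z" "U = ?C ` Z"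
    using UT by (auto simp: subset_image_inj)
  obtain zs where zs: "set zs = Z" "distinct zs"
    using finite_distinct_list[of Z] Z(1) finite_subset by blast
  have len: "length zs = kernel_rank f xs ys"
    using zs Z card by (simp add: card_image distinct_card[symmetric])
  have dz: "distinct (cols (kernel_mat f xs zs))"
    using zs Z by (simp add: cols_kernel_mat distinct_map)
  have "kernel_rank f xs zs = length zs"
    unfolding kernel_rank_def using lin_indpt_full_rank[OF kernel_mat_carrier dz] li zs Z
    by (simp add: cols_kernel_mat)
  \<comment> \<open>The columns of \<open>zs\<close> have the same rank as those of
    \<open>ys\<close>, hence generate them.\<close>
  then have "col_comb f (set xs) (set zs) y" if "y \<in> set ys" for y
    using col_comb_if_kernel_rank_eq[OF assms _ zs(2), of f xs y] col_comb_member[of "set ys"]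
      that zs Z len by auto
  with zs Z len that show ?thesis by blast
qed


text \<open>A column relation valid on the rows \<open>ws\<close> passes to their combinations
  \<open>xs\<close>. So a column basis for \<open>ws\<close> still generates on \<open>xs\<close>,
  and its length bounds the rank there.\<close>

lemma kernel_rank_mono_rows:
  fixes f :: "'a \<Rightarrow> 'b \<Rightarrow> 'c :: field"
  assumes "distinct ys" "\<And>x. x \<in> set xs \<Longrightarrow> col_comb (\<lambda>y x. f x y) (set ys) (set ws) x"
  shows "kernel_rank f xs ys \<le> kernel_rank f ws ys"
proof -
  obtain zs where zs: "distinct zs" "set zs \<subseteq> set ys" "length zs = kernel_rank f ws ys"
    "\<And>y. y \<in> set ys \<Longrightarrow> col_comb f (set ws) (set zs) y"
    using kernel_rank_basis[OF assms(1), of f ws] by blast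
  have "col_comb f (set xs) (set zs) y" if y: "y \<in> set ys" for y
  proof -
    obtain d where d: "\<And>w. w \<in> set ws \<Longrightarrow> f w y = (\<Sum>z\<in>set zs. d z * f w z)"
      using zs(4)[OF y] unfolding col_comb_def by blast
    have "f x y = (\<Sum>z\<in>set zs. d z * f x z)" if x: "x \<in> set xs" for x
    proof -
      obtain c where c: "\<And>y. y \<in> set ys \<Longrightarrow> f x y = (\<Sum>w\<in>set ws. c w * f w y)"
        using assms(2)[OF x] unfolding col_comb_def by blast
      have "f x y = (\<Sum>w\<in>set ws. \<Sum>z\<in>set zs. c w * (d z * f w z))"
        using c[OF y] d by (simp add: sum_distrib_left)
      also have "\<dots> = (\<Sum>z\<in>set zs. \<Sum>w\<in>set ws. c w * (d z * f w z))"
        by (rule sum.swap)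
      also have "\<dots> = (\<Sum>z\<in>set zs. d z * f x z)"
        using c zs(2) by (intro sum.cong) (auto simp: sum_distrib_left mult_ac)
      finally show ?thesis .
    qed
    then show ?thesis unfolding col_comb_def by blast
  qed
  then have "kernel_rank f xs ys \<le> kernel_rank f xs zs"
    by (rule kernel_rank_mono_cols[OF zs(1)])
  also have "\<dots> \<le> length zs"
    unfolding kernel_rank_def by (rule vec_space.rank_le_nc) simp
  finally show ?thesis using zs(3) by simp
qed

text \<open>The rank of the block with rows \<open>ys\<close> and columns \<open>xs\<close> lies
  between the two ranks. If these agree, that block has the rank of the whole matrix, so its columns
  generate all others.\<close>

lemma
  fixes f :: "'a \<Rightarrow> 'a \<Rightarrow> 'c :: field"
  assumes "distinct xs" "distinct ys" "set xs \<subseteq> set ys"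
  shows kernel_rank_principal_le: "kernel_rank f xs xs \<le> kernel_rank f ys ys"
    and col_comb_if_principal_rank_eq: "kernel_rank f xs xs = kernel_rank f ys ys
      \<Longrightarrow> z \<in> set ys \<Longrightarrow> col_comb f (set ys) (set xs) z"
proof -
  have rows: "kernel_rank f xs xs \<le> kernel_rank f ys xs"
    using assms by (intro kernel_rank_mono_rows col_comb_member) auto
  have comb: "col_comb f (set ys) (set ys) z" if "z \<in> set xs" for z
    using assms that by (intro col_comb_member) auto
  have cols: "kernel_rank f ys xs \<le> kernel_rank f ys ys"
    by (rule kernel_rank_mono_cols[OF assms(2) comb])
  show "kernel_rank f xs xs \<le> kernel_rank f ys ys"
    using rows cols by simp
  assume "kernel_rank f xs xs = kernel_rank f ys ys" "z \<in> set ys"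
  then show "col_comb f (set ys) (set xs) z"
    using col_comb_if_kernel_rank_eq[OF assms(2) comb assms(1)] rows cols by simp
qed

text \<open>The columns in \<open>xs\<close> generate all columns; by symmetry the rows in
  \<open>xs\<close> generate all rows with the same coefficients. Dropping the other columns and
  then the other rows does not lower the rank.\<close>

lemma kernel_rank_le_principal:
  fixes f :: "'a \<Rightarrow> 'a \<Rightarrow> 'c :: field"
  assumes "distinct xs" "distinct ys" "set xs \<subseteq> set ys"
    and sym: "\<And>u v. u \<in> set ys \<Longrightarrow> v \<in> set ys \<Longrightarrow> f u v = f v u"
    and comb: "\<And>z. z \<in> set ys \<Longrightarrow> col_comb f (set ys) (set xs) z"
  shows "kernel_rank f ys ys \<le> kernel_rank f xs xs"
proof -
  have "kernel_rank f ys ys \<le> kernel_rank f ys xs"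
    by (rule kernel_rank_mono_cols[OF assms(1) comb])
  also have "\<dots> \<le> kernel_rank f xs xs"
  proof (rule kernel_rank_mono_rows[OF assms(1)])
    fix z assume z: "z \<in> set ys"
    from comb[OF z] obtain c where c: "\<And>y. y \<in> set ys \<Longrightarrow> f y z = (\<Sum>x\<in>set xs. c x * f y x)"
      unfolding col_comb_def by blast
    have "f z y = (\<Sum>x\<in>set xs. c x * f x y)" if "y \<in> set xs" for y
    proof -
      have "f z y = f y z" using sym z that assms(3) by blast
      also have "\<dots> = (\<Sum>x\<in>set xs. c x * f y x)" using c that assms(3) by blast
      also have "\<dots> = (\<Sum>x\<in>set xs. c x * f x y)"
        using sym[of y] that assms(3) by (intro sum.cong) auto
      finally show ?thesis .
    qed
    then show "col_comb (\<lambda>y x. f x y) (set xs) (set xs) z"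
      unfolding col_comb_def by blast
  qed
  finally show ?thesis .
qed

subsection \<open>Moment matrices\<close>

lemma finite_words [simp]: "finite (words n d)"
  using finite_lists_length_le[of "{..<n}" d] by (simp add: words_def)

lemma words_mono: "d \<le> e \<Longrightarrow> words n d \<subseteq> words n e"
  by (auto simp: words_def)

lemma word_list_prefix: "\<exists>zs. word_list n (Suc d) = word_list n d @ zs"
  by (auto simp: word_list_def simp del: n_lists.simps)

lemma moment_matrix_eq_kernel_mat:
  "moment_matrix n d y = kernel_mat (\<lambda>u v. y (rev u @ v)) (word_list n d) (word_list n d)"
  by (simp add: moment_matrix_def kernel_mat_def)

lemma mat_rank_moment_matrix:
  "mat_rank (moment_matrix n d y) = kernel_rank (\<lambda>u v. y (rev u @ v)) (word_list n d) (word_list n d)"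
  by (simp add: moment_matrix_eq_kernel_mat kernel_rank_def) (simp add: kernel_mat_def)

lemma moment_matrix_cong:
  assumes "\<And>w. w \<in> words n (2 * d) \<Longrightarrow> y w = y' w"
  shows "moment_matrix n d y = moment_matrix n d y'"
proof -
  have "y (rev (word_list n d ! i) @ word_list n d ! j) = y' (rev (word_list n d ! i) @ word_list n d ! j)"
    if "i < length (word_list n d)" "j < length (word_list n d)" for i j
    using nth_mem[OF that(1)] nth_mem[OF that(2)] unfolding set_word_list
    by (intro assms) (auto simp: words_def)
  then show ?thesis by (auto simp: moment_matrix_def intro!: eq_matI)
qed

lemma truncated_tracial_seq_sym:
  assumes "truncated_tracial_seq n (2 * d) y" "u \<in> words n d" "v \<in> words n d"
  shows "y (rev u @ v) = y (rev v @ u)"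
proof -
  have "rev u @ v \<in> words n (2 * d)" using assms by (auto simp: words_def)
  then have "y (rev u @ v) = y (rev (rev u @ v))"
    using assms(1) by (auto simp: truncated_tracial_seq_def)
  then show ?thesis by simp
qed

lemma truncated_tracial_seq_append_commute:
  assumes "truncated_tracial_seq n m y" "u @ v \<in> words n m"
  shows "y (u @ v) = y (v @ u)"
proof -
  have "v @ u = rotate (length u) (u @ v)" by (simp add: rotate_append)
  then have "cyc_equiv (u @ v) (v @ u)" unfolding cyc_equiv_def by blast
  moreover have "v @ u \<in> words n m" using assms(2) by (auto simp: words_def)
  ultimately show ?thesis using assms unfolding truncated_tracial_seq_def by blast
qed

text \<open>The block shape comes from \<open>word_list n d\<close> being a prefix of
  \<open>word_list n (Suc d)\<close>; symmetry of the entries makes the two off-diagonal blocks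
  transposes of each other.\<close>

lemma flat_extension_moment_matrix:
  assumes "\<And>u v. u \<in> words n (Suc d) \<Longrightarrow> v \<in> words n (Suc d) \<Longrightarrow> y (rev u @ v) = y (rev v @ u)"
    and "mat_rank (moment_matrix n d y) = mat_rank (moment_matrix n (Suc d) y)"
  shows "flat_extension (moment_matrix n d y) (moment_matrix n (Suc d) y)"
proof -
  obtain zs where zs: "word_list n (Suc d) = word_list n d @ zs" using word_list_prefix by blast
  let ?f = "\<lambda>u v. y (rev u @ v)"
  let ?ws = "word_list n d"
  have sym: "?f u v = ?f v u" if "u \<in> set ?ws \<union> set zs" "v \<in> set ?ws \<union> set zs" for u v
    using assms(1) that set_word_list[of n "Suc d"] zs by auto
  have tr: "(kernel_mat ?f us vs)\<^sup>T = kernel_mat ?f vs us"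
    if "set us \<subseteq> set ?ws \<union> set zs" "set vs \<subseteq> set ?ws \<union> set zs" for us vs
    using that sym[OF subsetD[OF that(1) nth_mem] subsetD[OF that(2) nth_mem]]
    by (intro eq_matI) (auto simp: kernel_mat_def)
  have "kernel_mat ?f (?ws @ zs) (?ws @ zs) = four_block_mat (kernel_mat ?f ?ws ?ws)
      (kernel_mat ?f ?ws zs) (kernel_mat ?f zs ?ws) (kernel_mat ?f zs zs)"
    by (intro eq_matI) (auto simp: kernel_mat_def nth_append)
  moreover have "kernel_mat ?f zs ?ws = (kernel_mat ?f ?ws zs)\<^sup>T"
    by (subst tr) auto
  ultimately have "\<exists>r s B C. kernel_mat ?f ?ws ?ws \<in> carrier_mat r r \<and> B \<in> carrier_mat r s \<and>
      C \<in> carrier_mat s s \<and> kernel_mat ?f (?ws @ zs) (?ws @ zs) = four_block_mat (kernel_mat ?f ?ws ?ws) B B\<^sup>T C"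
    by (intro exI[of _ "length ?ws"] exI[of _ "length zs"]
        exI[of _ "kernel_mat ?f ?ws zs"] exI[of _ "kernel_mat ?f zs zs"]) simp
  then show ?thesis
    using assms(2) tr[of ?ws ?ws] tr[of "?ws @ zs" "?ws @ zs"]
    unfolding flat_extension_def moment_matrix_eq_kernel_mat zs by simp
qed

subsection \<open>Multiplication operators and the extension\<close>

text \<open>\<open>p v\<close> holds the coefficients of a polynomial of degree at most
  \<open>k - 1\<close> congruent to \<open>v\<close> modulo the kernel of the moment matrix. It is
  one fixed choice; no uniqueness is assumed.\<close>

locale flat_tracial_seq =
  fixes n k :: nat and y :: "nat list \<Rightarrow> real" and p :: "nat list \<Rightarrow> nat list \<Rightarrow> real"
  assumes k_pos: "1 \<le> k"
    and tracial: "truncated_tracial_seq n (2 * k) y"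
    and reduce: "\<And>u v. u \<in> words n k \<Longrightarrow> v \<in> words n k \<Longrightarrow>
      y (rev u @ v) = (\<Sum>a\<in>words n (k - 1). p v a * y (rev u @ a))"
begin

abbreviation "W \<equiv> words n (k - 1)"

text \<open>
  A function \<open>f\<close> stands for the polynomial with coefficient \<open>f a\<close> at \<open>a \<in> W\<close>; its values
  outside \<open>W\<close> are irrelevant. Such functions represent the quotient of the polynomials of degree
  at most \<open>k\<close> by the kernel of the moment matrix, so identities between them are only meaningful
  inside the bilinear form.
\<close>

definition form :: "(nat list \<Rightarrow> nat list) \<Rightarrow> (nat list \<Rightarrow> nat list) \<Rightarrow>
    (nat list \<Rightarrow> real) \<Rightarrow> (nat list \<Rightarrow> real) \<Rightarrow> real" where
  "form q r f g = (\<Sum>a\<in>W. \<Sum>b\<in>W. f a * g b * y (rev (q a) @ r b))"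

text \<open>The linear extension of a word operation \<open>q\<close>, which may raise the degree to
  \<open>k\<close>, followed by the reduction \<open>p\<close> back to degree at most
  \<open>k - 1\<close>. In contrast, \<open>form q r\<close> pairs the images under \<open>q\<close>
  and \<open>r\<close> unreduced.\<close>

definition lift :: "(nat list \<Rightarrow> nat list) \<Rightarrow> (nat list \<Rightarrow> real) \<Rightarrow> nat list \<Rightarrow> real" where
  "lift q g = (\<lambda>a. \<Sum>b\<in>W. g b * p (q b) a)"

abbreviation ip :: "(nat list \<Rightarrow> real) \<Rightarrow> (nat list \<Rightarrow> real) \<Rightarrow> real" where
  "ip \<equiv> form id id"

abbreviation "mult_left X \<equiv> lift (Cons X)"

abbreviation "mult_right X \<equiv> lift (\<lambda>w. w @ [X])"

definition apply_word :: "nat list \<Rightarrow> (nat list \<Rightarrow> real) \<Rightarrow> nat list \<Rightarrow> real" where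
  "apply_word w g = foldr (\<lambda>X. mult_left X) w g"

definition unit_coeff :: "nat list \<Rightarrow> real" where
  "unit_coeff = (\<lambda>w. if w = [] then 1 else 0)"

text \<open>A representative of the class of \<open>w\<close> in the quotient, available for words
  of every length.\<close>

definition word_coeff :: "nat list \<Rightarrow> nat list \<Rightarrow> real" where
  "word_coeff w = apply_word w unit_coeff"

definition extend :: "nat list \<Rightarrow> real" where
  "extend w = ip unit_coeff (word_coeff w)"

section \<open>Reduction inside the form, self-adjointness and commutation\<close>

lemma y_sym: "u \<in> words n k \<Longrightarrow> v \<in> words n k \<Longrightarrow> y (rev u @ v) = y (rev v @ u)"
  by (rule truncated_tracial_seq_sym[OF tracial])

lemma W_subset: "w \<in> W \<Longrightarrow> w \<in> words n k"
  using words_mono[of "k - 1" k n] by auto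

lemma Cons_W: "X < n \<Longrightarrow> w \<in> W \<Longrightarrow> X # w \<in> words n k"
  using k_pos by (auto simp: words_def)

lemma snoc_W: "X < n \<Longrightarrow> w \<in> W \<Longrightarrow> w @ [X] \<in> words n k"
  using k_pos by (auto simp: words_def)

lemma form_sym:
  assumes "\<And>w. w \<in> W \<Longrightarrow> q w \<in> words n k" "\<And>w. w \<in> W \<Longrightarrow> r w \<in> words n k"
  shows "form q r f g = form r q g f"
  unfolding form_def using assms
  by (subst sum.swap) (intro sum.cong refl, simp add: y_sym mult.commute)

text \<open>The reduction inside \<open>lift\<close> can be undone as long as the other argument has
  degree at most \<open>k\<close>, for then \<open>reduce\<close> applies to every row
  \<open>q b\<close>.\<close>

lemma form_lift_left:
  assumes "\<And>w. w \<in> W \<Longrightarrow> q w \<in> words n k" "\<And>w. w \<in> W \<Longrightarrow> r w \<in> words n k"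
  shows "form id q (lift r f) g = form r q f g"
proof -
  have "form id q (lift r f) g = (\<Sum>a\<in>W. \<Sum>b\<in>W. \<Sum>c\<in>W. f c * g b * (p (r c) a * y (rev (q b) @ a)))"
    unfolding form_def lift_def using assms
    by (intro sum.cong refl) (simp add: sum_distrib_left sum_distrib_right mult_ac y_sym W_subset)
  also have "\<dots> = (\<Sum>b\<in>W. \<Sum>a\<in>W. \<Sum>c\<in>W. f c * g b * (p (r c) a * y (rev (q b) @ a)))"
    by (rule sum.swap)
  also have "\<dots> = (\<Sum>b\<in>W. \<Sum>c\<in>W. \<Sum>a\<in>W. f c * g b * (p (r c) a * y (rev (q b) @ a)))"
    by (intro sum.cong refl sum.swap)
  also have "\<dots> = (\<Sum>b\<in>W. \<Sum>c\<in>W. f c * g b * y (rev (q b) @ r c))"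
    using assms by (intro sum.cong refl) (simp add: reduce sum_distrib_left)
  also have "\<dots> = form q r g f"
    unfolding form_def by (intro sum.cong refl) simp
  finally show ?thesis using form_sym[OF assms] by simp
qed

lemma form_lift_right:
  assumes "\<And>w. w \<in> W \<Longrightarrow> q w \<in> words n k" "\<And>w. w \<in> W \<Longrightarrow> r w \<in> words n k"
  shows "form q id f (lift r g) = form q r f g"
proof -
  have "form q id f (lift r g) = form id q (lift r g) f"
    using assms W_subset by (intro form_sym) auto
  then show ?thesis using form_lift_left[OF assms] form_sym[OF assms] by simp
qed

lemma
  assumes "\<And>w. w \<in> W \<Longrightarrow> q w \<in> words n k"
  shows ip_lift_left: "ip (lift q f) g = form q id f g"
    and ip_lift_right: "ip f (lift q g) = form id q f g"
  using assms W_subset by (auto intro: form_lift_left form_lift_right)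

lemma ip_lift_simps:
  assumes "X < n"
  shows "ip (mult_left X f) g = form (Cons X) id f g" "ip f (mult_left X g) = form id (Cons X) f g"
    "ip (mult_right X f) g = form (\<lambda>w. w @ [X]) id f g" "ip f (mult_right X g) = form id (\<lambda>w. w @ [X]) f g"
  using assms by (auto intro!: ip_lift_left ip_lift_right Cons_W snoc_W)

lemma ip_sym: "ip f g = ip g f"
  by (rule form_sym) (auto intro: W_subset)

text \<open>Once the reductions are undone, both sides pair through the same word, since
  \<open>rev (X # a) @ b\<close> equals \<open>rev a @ X # b\<close>.\<close>

lemma ip_mult_left:
  assumes "X < n"
  shows "ip (mult_left X f) g = ip f (mult_left X g)"
proof -
  have "form (Cons X) id f g = form id (Cons X) f g"
    by (simp add: form_def)
  then show ?thesis
    using assms by (simp add: ip_lift_simps)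
qed

text \<open>Here the two words differ by moving \<open>X\<close> from the front to the back, so
  cyclic invariance of \<open>y\<close> is what makes right multiplication self-adjoint.\<close>

lemma ip_mult_right:
  assumes "X < n"
  shows "ip (mult_right X f) g = ip f (mult_right X g)"
proof -
  have "y (X # rev a @ b) = y (rev a @ b @ [X])" if "a \<in> W" "b \<in> W" for a b
    using truncated_tracial_seq_append_commute[OF tracial, of "[X]" "rev a @ b"] that assms k_pos
    by (auto simp: words_def)
  then have "form (\<lambda>w. w @ [X]) id f g = form id (\<lambda>w. w @ [X]) f g"
    unfolding form_def by (intro sum.cong refl) simp
  then show ?thesis
    using assms by (simp add: ip_lift_simps)
qed

text \<open>Moving one operator to each side leaves a single reduction per argument to undo. What
  remains is a cyclic shift of words of length at most \<open>2 * k\<close>, just within the range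
  of \<open>y\<close>.\<close>

lemma ip_mult_left_mult_right:
  assumes "X < n" "Y < n"
  shows "ip (mult_right X (mult_left Y f)) g = ip (mult_left Y (mult_right X f)) g"
proof -
  have q: "Y # w \<in> words n k" "w @ [X] \<in> words n k" if "w \<in> W" for w
    using assms that by (simp_all add: Cons_W snoc_W)
  have y: "y (rev a @ Y # b @ [X]) = y (X # rev a @ Y # b)" if "a \<in> W" "b \<in> W" for a b
    using truncated_tracial_seq_append_commute[OF tracial, of "[X]" "rev a @ Y # b"] that assms k_pos
    by (auto simp: words_def)
  have "ip (mult_right X (mult_left Y f)) g = ip (mult_left Y f) (mult_right X g)"
    by (rule ip_mult_right[OF assms(1)])
  also have "\<dots> = form id (\<lambda>w. w @ [X]) (mult_left Y f) g"
    by (rule ip_lift_right[OF q(2)])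
  also have "\<dots> = form (Cons Y) (\<lambda>w. w @ [X]) f g"
    by (rule form_lift_left[OF q(2) q(1)])
  also have "\<dots> = form (\<lambda>w. w @ [X]) (Cons Y) f g"
    unfolding form_def by (intro sum.cong refl) (simp add: y)
  also have "\<dots> = form id (Cons Y) (mult_right X f) g"
    by (rule form_lift_left[OF q, symmetric])
  also have "\<dots> = ip (mult_right X f) (mult_left Y g)"
    by (rule ip_lift_right[OF q(1), symmetric])
  also have "\<dots> = ip (mult_left Y (mult_right X f)) g"
    by (rule ip_mult_left[OF assms(2), symmetric])
  finally show ?thesis .
qed

section \<open>The action of words and the classes they represent\<close>

lemma apply_word_Nil [simp]: "apply_word [] g = g"
  and apply_word_Cons [simp]: "apply_word (X # w) g = mult_left X (apply_word w g)"
  and apply_word_append: "apply_word (u @ v) g = apply_word u (apply_word v g)"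
  by (simp_all add: apply_word_def)

lemma ip_apply_word:
  "set w \<subseteq> {..<n} \<Longrightarrow> ip (apply_word w f) g = ip f (apply_word (rev w) g)"
  by (induction w arbitrary: g) (simp_all add: ip_mult_left apply_word_append)

text \<open>Commutation holds only inside the form, so in the induction each left multiplication is
  moved over to \<open>g\<close>, which must therefore be arbitrary.\<close>

lemma ip_apply_word_mult_right:
  assumes "X < n"
  shows "set w \<subseteq> {..<n} \<Longrightarrow> ip (mult_right X (apply_word w f)) g = ip (apply_word w (mult_right X f)) g"
  using assms by (induction w arbitrary: g) (simp_all add: ip_mult_left_mult_right ip_mult_left)

lemma sum_unit_coeff: "(\<Sum>a\<in>W. unit_coeff a * h a) = h []"
proof -
  have "[] \<in> W" by (simp add: words_def)
  then show ?thesis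
    by (simp add: unit_coeff_def if_distrib[of "\<lambda>t. t * _"] cong: if_cong)
qed

lemma form_unit_coeff: "form q r f unit_coeff = (\<Sum>a\<in>W. f a * y (rev (q a) @ r []))"
proof -
  have "(\<Sum>b\<in>W. f a * unit_coeff b * y (rev (q a) @ r b)) = f a * y (rev (q a) @ r [])" for a
    using sum_unit_coeff[of "\<lambda>b. f a * y (rev (q a) @ r b)"] by (simp add: mult_ac)
  then show ?thesis by (simp add: form_def)
qed

text \<open>Multiplying the empty word by \<open>X\<close> gives the word \<open>[X]\<close> from
  either side. This is where left and right multiplication meet.\<close>

lemma ip_mult_left_unit:
  assumes "X < n"
  shows "ip f (mult_left X unit_coeff) = ip f (mult_right X unit_coeff)"
  using assms by (simp add: ip_lift_simps form_unit_coeff)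

lemma ip_word_coeff:
  "w \<in> words n k \<Longrightarrow> ip g (word_coeff w) = (\<Sum>a\<in>W. g a * y (rev a @ w))"
proof (induction w arbitrary: g)
  case Nil
  then show ?case by (simp add: word_coeff_def form_unit_coeff)
next
  case (Cons X w)
  then have X: "X < n" and w: "w \<in> W" by (auto simp: words_def)
  \<comment> \<open>The monomial \<open>w\<close> itself, which needs no reduction because its
    degree is at most \<open>k - 1\<close>. By the induction hypothesis it pairs like
    \<open>word_coeff w\<close>.\<close>
  define d where "d = (\<lambda>a. if a = w then 1 else 0 :: real)"
  have d: "form q r f d = (\<Sum>a\<in>W. f a * y (rev (q a) @ r w))" for q r f
  proof -
    have "f a * d b * y (rev (q a) @ r b) = (if b = w then f a * y (rev (q a) @ r w) else 0)" for a b
      by (simp add: d_def)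
    then show ?thesis using w unfolding form_def by simp
  qed
  have "ip g (word_coeff (X # w)) = ip (mult_left X g) (word_coeff w)"
    using X by (simp add: word_coeff_def ip_mult_left)
  also have "\<dots> = ip (mult_left X g) d"
    unfolding d Cons.IH[OF W_subset[OF w]] by simp
  also have "\<dots> = form id (Cons X) g d"
    using X by (simp add: ip_mult_left ip_lift_simps(2))
  also have "\<dots> = (\<Sum>a\<in>W. g a * y (rev a @ X # w))"
    unfolding d id_apply ..
  finally show ?case .
qed

lemma ip_eq_word_coeff:
  assumes "w \<in> words n k"
  shows "ip g (p w) = ip g (word_coeff w)"
proof -
  have "(\<Sum>b\<in>W. g a * p w b * y (rev (id a) @ id b)) = g a * y (rev a @ w)" if "a \<in> W" for a
    using reduce[OF W_subset[OF that] assms] by (simp add: sum_distrib_left mult_ac)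
  then show ?thesis unfolding ip_word_coeff[OF assms] unfolding form_def by (intro sum.cong refl)
qed

section \<open>The extended sequence: Gram form, invariance and flatness\<close>

text \<open>Adjointness moves \<open>rev u\<close> to the first argument, which exhibits the moment
  matrices of \<open>extend\<close> as Gram matrices.\<close>

lemma extend_rev_append:
  assumes "set u \<subseteq> {..<n}"
  shows "extend (rev u @ v) = ip (word_coeff u) (word_coeff v)"
  unfolding extend_def word_coeff_def apply_word_append ip_apply_word[OF assms] ..

lemma extend_eq:
  assumes "w \<in> words n (2 * k)"
  shows "extend w = y w"
proof -
  \<comment> \<open>Cutting after \<open>k\<close> letters keeps both factors of degree at most
    \<open>k\<close>, where \<open>ip_word_coeff\<close> evaluates the form.\<close>
  define u v where "u = rev (take k w)" and "v = drop k w"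
  have u: "u \<in> words n k" and v: "v \<in> words n k" and w: "w = rev u @ v"
    using assms set_take_subset[of k w] set_drop_subset[of k w]
    by (auto simp: words_def u_def v_def)
  have "extend w = ip (word_coeff u) (word_coeff v)"
    unfolding w by (rule extend_rev_append) (use u in \<open>simp add: words_def\<close>)
  also have "\<dots> = ip (p v) (word_coeff u)"
    unfolding ip_sym[of "p v"] ip_eq_word_coeff[OF v] ..
  also have "\<dots> = (\<Sum>a\<in>W. p v a * y (rev u @ a))"
    unfolding ip_word_coeff[OF u] using u by (intro sum.cong refl) (simp add: y_sym W_subset)
  also have "\<dots> = y w" unfolding w by (rule reduce[OF u v, symmetric])
  finally show ?thesis .
qed

lemma extend_rev:
  assumes "set w \<subseteq> {..<n}"
  shows "extend (rev w) = extend w"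
  using extend_rev_append[OF assms, of "[]"] ip_sym unfolding extend_def by (simp add: word_coeff_def)

text \<open>The letter \<open>X\<close> acts on the unit first, so it may be read as a right
  multiplication. As such it crosses the form, commutes past the letters of \<open>u\<close>, and is
  turned back into a left multiplication.\<close>

lemma extend_rotate1:
  assumes "set w \<subseteq> {..<n}"
  shows "extend (rotate1 w) = extend w"
proof (cases w)
  case (Cons X u)
  then have X: "X < n" and u: "set u \<subseteq> {..<n}" using assms by auto
  have ru: "set (rev u) \<subseteq> {..<n}" using u by simp
  note aw = ip_apply_word[OF ru, simplified]
  have "extend (u @ [X]) = ip (apply_word (rev u) unit_coeff) (mult_left X unit_coeff)"
    by (simp add: extend_def word_coeff_def apply_word_append aw)
  also have "\<dots> = ip (mult_right X (apply_word (rev u) unit_coeff)) unit_coeff"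
    using X by (simp add: ip_mult_left_unit ip_mult_right)
  also have "\<dots> = ip (mult_right X unit_coeff) (apply_word u unit_coeff)"
    by (simp add: ip_apply_word_mult_right[OF X ru] aw)
  also have "\<dots> = ip (mult_left X unit_coeff) (apply_word u unit_coeff)"
    unfolding ip_sym[of "lift _ _"] ip_mult_left_unit[OF X] ..
  also have "\<dots> = extend (X # u)"
    using X by (simp add: extend_def word_coeff_def ip_mult_left)
  finally show ?thesis by (simp add: Cons)
qed simp

lemma extend_rotate:
  "set w \<subseteq> {..<n} \<Longrightarrow> extend (rotate i w) = extend w"
  by (induction i) (simp_all add: extend_rotate1)

lemma truncated_tracial_seq_extend:
  "truncated_tracial_seq n m (restrict extend (words n m))"
proof -
  have "extend [] = 1"
    using extend_eq[of "[]"] tracial by (simp add: words_def truncated_tracial_seq_def)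
  moreover have "rev w \<in> words n m \<longleftrightarrow> w \<in> words n m" for w by (simp add: words_def)
  ultimately show ?thesis
    unfolding truncated_tracial_seq_def cyc_equiv_def
    by (auto simp: words_def extend_rev extend_rotate)
qed

text \<open>The coefficients do not depend on \<open>u\<close>, so this is a relation between
  columns: every column is a combination of those indexed by \<open>W\<close>.\<close>

lemma extend_reduce:
  assumes "set u \<subseteq> {..<n}" "set v \<subseteq> {..<n}"
  shows "extend (rev u @ v) = (\<Sum>a\<in>W. word_coeff v a * extend (rev u @ a))"
proof -
  have "extend (rev u @ v) = (\<Sum>b\<in>W. \<Sum>a\<in>W. word_coeff u b * word_coeff v a * y (rev b @ a))"
    using extend_rev_append[OF assms(1)] by (simp add: form_def)
  also have "\<dots> = (\<Sum>a\<in>W. \<Sum>b\<in>W. word_coeff u b * word_coeff v a * y (rev b @ a))"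
    by (rule sum.swap)
  also have "\<dots> = (\<Sum>a\<in>W. word_coeff v a * extend (rev u @ a))"
    by (intro sum.cong refl)
      (simp add: extend_rev_append[OF assms(1)] ip_word_coeff W_subset sum_distrib_left mult_ac)
  finally show ?thesis .
qed

lemma flat_extension_extend:
  assumes "mat_rank (moment_matrix n k y) = mat_rank (moment_matrix n (k - 1) y)"
  defines "y' \<equiv> restrict extend (words n (2 * k + 2))"
  shows "flat_extension (moment_matrix n k y) (moment_matrix n (Suc k) y')"
proof -
  let ?f = "\<lambda>u v. y' (rev u @ v)"
  have y': "y' w = y w" if "w \<in> words n (2 * k)" for w
    using that words_mono[of "2 * k" "2 * k + 2" n] by (auto simp: y'_def extend_eq)
  then have eq: "moment_matrix n k y' = moment_matrix n k y"
    "moment_matrix n (k - 1) y' = moment_matrix n (k - 1) y"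
    using words_mono[of "2 * (k - 1)" "2 * k" n] by (auto intro!: moment_matrix_cong)
  have f: "?f u v = extend (rev u @ v)" if "u \<in> words n (Suc k)" "v \<in> words n (Suc k)" for u v
    using that by (auto simp: y'_def words_def)
  have sym: "?f u v = ?f v u" if "u \<in> words n (Suc k)" "v \<in> words n (Suc k)" for u v
    using truncated_tracial_seq_sym[of n "Suc k" y' u v] that truncated_tracial_seq_extend
    by (simp add: y'_def)
  have W: "W \<subseteq> words n (Suc k)" by (rule words_mono) simp
  have comb: "col_comb ?f (words n (Suc k)) W v" if v: "v \<in> words n (Suc k)" for v
    unfolding col_comb_def
  proof (intro exI ballI)
    fix u assume u: "u \<in> words n (Suc k)"
    have "(\<Sum>a\<in>W. word_coeff v a * extend (rev u @ a)) = (\<Sum>a\<in>W. word_coeff v a * ?f u a)"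
      using W u by (intro sum.cong refl) (auto simp: f)
    then show "?f u v = (\<Sum>a\<in>W. word_coeff v a * ?f u a)"
      using extend_reduce[of u v] u v f[OF u v] by (simp add: words_def)
  qed
  \<comment> \<open>The bound goes down to order \<open>k - 1\<close>, and the rank hypothesis lifts
    it back to order \<open>k\<close>.\<close>
  have "mat_rank (moment_matrix n (Suc k) y') \<le> mat_rank (moment_matrix n (k - 1) y')"
    unfolding mat_rank_moment_matrix using W sym comb
    by (intro kernel_rank_le_principal) (auto simp: distinct_word_list set_word_list)
  moreover have "mat_rank (moment_matrix n k y') \<le> mat_rank (moment_matrix n (Suc k) y')"
    unfolding mat_rank_moment_matrix using words_mono[of k "Suc k" n]
    by (intro kernel_rank_principal_le) (auto simp: distinct_word_list set_word_list)
  ultimately have "mat_rank (moment_matrix n k y') = mat_rank (moment_matrix n (Suc k) y')"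
    using assms(1) unfolding eq by linarith
  then show ?thesis
    using flat_extension_moment_matrix[of n k y', OF sym] by (simp add: eq)
qed

section \<open>Uniqueness of the flat extension\<close>

text \<open>
  By flatness, a relation between columns that holds on the rows in \<open>words n k\<close> propagates to
  those in \<open>words n (Suc k)\<close>. Hence the kernel of the flat extension is closed under left
  multiplication by a letter, as far as degrees permit.
\<close>

lemma flat_extension_reduce:
  assumes z: "truncated_tracial_seq n (2 * k + 2) z" "\<forall>w\<in>words n (2 * k). z w = y w"
    and flat: "flat_extension (moment_matrix n k y) (moment_matrix n (Suc k) z)"
    and u: "u \<in> words n (Suc k)" and v: "v \<in> words n k" and X: "X < n"
  shows "z (rev u @ X # v) = (\<Sum>a\<in>W. p v a * z (rev u @ X # a))"
proof -
  let ?f = "\<lambda>u v. z (rev u @ v)"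
  have sub: "words n k \<subseteq> words n (Suc k)" by (rule words_mono) simp
  have sym: "?f u v = ?f v u" if "u \<in> words n (Suc k)" "v \<in> words n (Suc k)" for u v
    using truncated_tracial_seq_sym[of n "Suc k" z u v] that z(1) by simp
  have eq: "moment_matrix n k z = moment_matrix n k y"
    using z(2) by (auto intro: moment_matrix_cong)
  have rank: "mat_rank (moment_matrix n k z) = mat_rank (moment_matrix n (Suc k) z)"
    using flat unfolding flat_extension_def eq by blast
  have comb: "\<exists>c. \<forall>u\<in>words n (Suc k). ?f u v = (\<Sum>b\<in>words n k. c b * ?f u b)"
    if v: "v \<in> words n (Suc k)" for v
    using col_comb_if_principal_rank_eq[OF distinct_word_list distinct_word_list,
        of n k n "Suc k" ?f v] rank v sub
    by (simp add: mat_rank_moment_matrix set_word_list col_comb_def)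
  \<comment> \<open>The map \<open>q\<close> serves two uses: the relation for \<open>v\<close> with
    terms \<open>a\<close>, and the one for \<open>X # v\<close> with terms
    \<open>X # a\<close>.\<close>
  have propagate: "\<forall>u\<in>words n (Suc k). ?f u v = (\<Sum>a\<in>W. c a * ?f u (q a))"
    if v: "v \<in> words n (Suc k)" and q: "\<And>a. a \<in> W \<Longrightarrow> q a \<in> words n (Suc k)"
      and h: "\<And>u. u \<in> words n k \<Longrightarrow> ?f u v = (\<Sum>a\<in>W. c a * ?f u (q a))"
    for v c q
  proof
    fix u assume u: "u \<in> words n (Suc k)"
    obtain d where d: "\<And>w. w \<in> words n (Suc k) \<Longrightarrow> ?f w u = (\<Sum>b\<in>words n k. d b * ?f w b)"
      using comb[OF u] by blast
    \<comment> \<open>By symmetry the row of \<open>u\<close> is a combination of rows of degree at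
      most \<open>k\<close>, on which the relation is already known.\<close>
    have d': "?f u w = (\<Sum>b\<in>words n k. d b * ?f b w)" if w: "w \<in> words n (Suc k)" for w
      unfolding sym[OF u w] d[OF w] using sub w by (intro sum.cong refl) (simp add: sym subsetD)
    have "?f u v = (\<Sum>b\<in>words n k. \<Sum>a\<in>W. d b * (c a * ?f b (q a)))"
      unfolding d'[OF v] by (intro sum.cong refl) (simp add: h sum_distrib_left)
    also have "\<dots> = (\<Sum>a\<in>W. \<Sum>b\<in>words n k. d b * (c a * ?f b (q a)))"
      by (rule sum.swap)
    also have "\<dots> = (\<Sum>a\<in>W. c a * ?f u (q a))"
      by (intro sum.cong refl) (simp add: d'[OF q] sum_distrib_left mult_ac)
    finally show "?f u v = (\<Sum>a\<in>W. c a * ?f u (q a))" .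
  qed
  have "?f u v = (\<Sum>a\<in>W. p v a * ?f u a)" if u: "u \<in> words n k" for u
  proof -
    have "z (rev u @ w) = y (rev u @ w)" if "w \<in> words n k" for w
      using u that by (intro bspec[OF z(2)]) (auto simp: words_def)
    then show ?thesis using reduce[OF u v] v by (simp add: W_subset)
  qed
  then have *: "\<forall>u\<in>words n (Suc k). ?f u v = (\<Sum>a\<in>W. p v a * ?f u a)"
    using v sub W_subset by (intro propagate) auto
  \<comment> \<open>Since \<open>rev (X # u) @ v\<close> equals \<open>rev u @ X # v\<close>, this
    is the relation \<open>*\<close> read at the row \<open>X # u\<close>.\<close>
  have "?f u (X # v) = (\<Sum>a\<in>W. p v a * ?f u (X # a))" if u: "u \<in> words n k" for u
  proof -
    have "X # u \<in> words n (Suc k)" using u X by (simp add: words_def)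
    with * show ?thesis by fastforce
  qed
  then have "\<forall>u\<in>words n (Suc k). ?f u (X # v) = (\<Sum>a\<in>W. p v a * ?f u (X # a))"
    using v X sub by (intro propagate) (auto intro: Cons_W simp: words_def)
  with u show ?thesis by blast
qed

text \<open>In \<open>rev u @ X # v\<close> with \<open>v\<close> of length \<open>k\<close>,
  reducing \<open>v\<close> shortens the word by at least one letter. Both extensions use the same
  coefficients \<open>p v\<close>, so agreement passes from each length to the next.\<close>

lemma flat_extension_unique:
  assumes "truncated_tracial_seq n (2 * k + 2) z" "\<forall>w\<in>words n (2 * k). z w = y w"
    and "flat_extension (moment_matrix n k y) (moment_matrix n (Suc k) z)"
    and "truncated_tracial_seq n (2 * k + 2) z'" "\<forall>w\<in>words n (2 * k). z' w = y w"
    and "flat_extension (moment_matrix n k y) (moment_matrix n (Suc k) z')"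
  shows "z = z'"
proof -
  note reduce_z = flat_extension_reduce[OF assms(1-3)]
  note reduce_z' = flat_extension_reduce[OF assms(4-6)]
  \<comment> \<open>\<open>m\<close> is the length of the left factor: \<open>m = k\<close> settles
    length \<open>2 * k + 1\<close>, and then \<open>m = Suc k\<close> settles length
    \<open>2 * k + 2\<close>.\<close>
  have step: "z w = z' w"
    if w: "w \<in> words n (m + k + 1)" and m: "m \<le> Suc k" "k \<le> m"
      and eq: "\<And>w. w \<in> words n (m + k) \<Longrightarrow> z w = z' w"
    for w m
  proof (cases "length w = m + k + 1")
    case False
    then show ?thesis using w by (intro eq) (simp add: words_def)
  next
    case True
    define u where "u = rev (take m w)"
    obtain X v where Xv: "drop m w = X # v" using True by (cases "drop m w") auto
    have w': "w = rev u @ X # v" unfolding u_def rev_rev_ident Xv[symmetric] by simp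
    have u: "u \<in> words n (Suc k)" "length u = m" and v: "v \<in> words n k" and X: "X < n"
      using w True m arg_cong[OF Xv, of length] unfolding w' by (auto simp: words_def u_def)
    have "z (rev u @ X # a) = z' (rev u @ X # a)" if "a \<in> W" for a
      using that u X k_pos by (intro eq) (auto simp: words_def)
    then show ?thesis
      unfolding w' reduce_z[OF u(1) v X] reduce_z'[OF u(1) v X] by simp
  qed
  have "z w = z' w" if "w \<in> words n (2 * k)" for w
    using assms(2,5) that by simp
  then have "z w = z' w" if "w \<in> words n (k + k + 1)" for w
    using that by (intro step[of w k]) (simp_all add: mult_2)
  then have "z w = z' w" if "w \<in> words n (2 * k + 2)" for w
    using that by (intro step[of w "Suc k"]) (simp_all add: mult_2)
  then show ?thesis
    using assms(1,4) unfolding truncated_tracial_seq_def by (blast intro: extensionalityI)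
qed

end

section \<open>Choice of the reduction and conclusion\<close>

text \<open>Equal ranks make the columns of degree at most \<open>k - 1\<close> generate those of
  degree at most \<open>k\<close>; a choice of coefficients for each \<open>v\<close> gives
  \<open>p\<close>.\<close>

lemma flat_tracial_seqI:
  assumes "1 \<le> k" "truncated_tracial_seq n (2 * k) y"
    and "mat_rank (moment_matrix n k y) = mat_rank (moment_matrix n (k - 1) y)"
  shows "\<exists>p. flat_tracial_seq n k y p"
proof -
  have "col_comb (\<lambda>u v. y (rev u @ v)) (words n k) (words n (k - 1)) v" if "v \<in> words n k" for v
    using col_comb_if_principal_rank_eq[OF distinct_word_list distinct_word_list,
        of n "k - 1" n k "\<lambda>u v. y (rev u @ v)" v] assms(3) that words_mono[of "k - 1" k n]
    by (simp add: mat_rank_moment_matrix set_word_list)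
  then obtain p where "\<forall>v\<in>words n k. \<forall>u\<in>words n k. y (rev u @ v) = (\<Sum>a\<in>words n (k - 1). p v a * y (rev u @ a))"
    unfolding col_comb_def by metis
  with assms show ?thesis unfolding flat_tracial_seq_def by blast
qed

theorem theorem3p18:
  fixes n k :: nat and y :: "nat list \<Rightarrow> real"
  assumes "k \<ge> 1"
    and "truncated_tracial_seq n (2 * k) y"
    and "mat_rank (moment_matrix n k y) = mat_rank (moment_matrix n (k - 1) y)"
  shows "\<exists>!y'. truncated_tracial_seq n (2 * k + 2) y' \<and>
           (\<forall>w \<in> words n (2 * k). y' w = y w) \<and>
           flat_extension (moment_matrix n k y) (moment_matrix n (k + 1) y')"
proof -
  obtain p where "flat_tracial_seq n k y p" using flat_tracial_seqI[OF assms] by blast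
  then interpret flat_tracial_seq n k y p .
  let ?y = "restrict extend (words n (2 * k + 2))"
  have "truncated_tracial_seq n (2 * k + 2) ?y" by (rule truncated_tracial_seq_extend)
  moreover have "\<forall>w\<in>words n (2 * k). ?y w = y w"
    using words_mono[of "2 * k" "2 * k + 2" n] by (auto simp: extend_eq)
  moreover have "flat_extension (moment_matrix n k y) (moment_matrix n (k + 1) ?y)"
    using flat_extension_extend[OF assms(3)] by simp
  moreover have "z = ?y" if "truncated_tracial_seq n (2 * k + 2) z \<and> (\<forall>w\<in>words n (2 * k). z w = y w) \<and>
      flat_extension (moment_matrix n k y) (moment_matrix n (k + 1) z)" for z
    using that calculation by (intro flat_extension_unique) auto
  ultimately show ?thesis by blast
qed

end
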